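(* Let $n,k$ be positive integers with $4\le 2k\le n$. Let $\mathcal{A}=\mathcal{F}([2,b])\cup\mathcal{F}(\{1,b\})\subseteq\binom{[n]}{k}$ with $4\le b\le k+1$ be an MLCIF of rank $2$ having exactly two maximal generators, and let $X\subseteq[2,n]$ with $|X|=d$. Let $\mathcal{S}=\{A\in\binom{[n]}{k}:1\in A\}$ and $\mu_X(b)=|X\cap[b]|$. Then: (i) If $X\cap[2,b]\ne\emptyset$, then $$|\mathcal{A}(X)|=\binom{n-1}{k-1}-\binom{n-b}{k-1}+\binom{n-b}{k-b+1}-\binom{n-d-1}{k-1}+\binom{n-d-b+\mu_X(b)}{k-1}.$$ In particular, if $X\subseteq[2,b]$, then $|\mathcal{A}(X)|=|\mathcal{S}(X)|+\binom{n-b}{k-b+1}$; and if $X\cap[2,b]\subsetneq X$, then for sufficiently large $n$ we have $|\mathcal{A}(X)|<|\mathcal{S}(X)|$. (ii) If $X\cap[2,b]=\emptyset$, then $$|\mathcal{A}(X)|=\binom{n-1}{k-1}-\binom{n-b}{k-1}+\binom{n-b}{k-b+1}-\binom{n-d-1}{k-1}+\binom{n-d-b}{k-1}-\binom{n-d-b}{k-b+1}.$$ Consequently, $|\mathcal{A}(X)|\le|\mathcal{S}(X)|$.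
   Context: Notation: $[n]=\{1,\dots,n\}$, $[m,n]=\{m,m+1,\dots,n\}$; $\binom{[n]}{k}$ is the set of all $k$-element subsets of $[n]$, and $\binom{[n]}{\le k}$ the set of all subsets of size at most $k$. Sets are always listed in increasing order. For a family $\mathcal{B}\subseteq 2^{[n]}$ and $X\subseteq[n]$, $\mathcal{B}(X)=\{B\in\mathcal{B}: B\cap X\ne\emptyset\}$. Orders: for two sets of the same size, $A=\{a_1<\dots<a_r\}$ and $B=\{b_1<\dots<b_r\}$, write $A\le B$ if $a_i\le b_i$ for all $i$. For $A=\{a_1<\dots<a_r\}$, $B=\{b_1<\dots<b_s\}$ write $A\preceq B$ if $r\ge s$ and $a_i\le b_i$ for all $1\le i\le s$. Generated families: for a collection $\mathcal{G}$ of subsets of $[n]$ of size at most $k$, $\mathcal{F}(\mathcal{G})=\{S\in\binom{[n]}{k}: S\preceq G\text{ for some }G\in\mathcal{G}\}$; for a single set $G$, $\mathcal{F}(G)=\mathcal{F}(\{G\})$. Families: $\mathcal{A}\subseteq\binom{[n]}{k}$ is intersecting if $S\cap T\ne\emptyset$ for all $S,T\in\mathcal{A}$; left-compressed if $A\in\mathcal{A}$, $B\in\binom{[n]}{k}$, $B\le A$ imply $B\in\mathcal{A}$. An intersecting family $\mathcal{A}\subseteq\binom{[n]}{k}$ is maximal if no other $k$-subset of $[n]$ can be added to it while preserving the intersecting property. An MLCIF is a maximal left-compressed intersecting family. Strong intersection: subsets $A,B$ of $[n]$ (possibly equal) are strongly intersecting if $A'\cap B'\ne\emptyset$ for all $A',B'\subseteq[n]$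 with $A'\le A$, $B'\le B$; a family is strongly intersecting if every pair of its members (including a member paired with itself) is. With $\mathcal{G}_k=\{G\in\binom{[2k-1]}{\le k}: |G\cap[k+|G|-1]|=|G|\}$, a principal generating set (PGS) is a strongly intersecting family $\mathcal{G}$ of members of $\mathcal{G}_k$ not containing $1$. Meet: for sets $A^1,\dots,A^m$ with $A^j=\{a^j_1<\dots<a^j_{r_j}\}$ and $d'=\max_j r_j$, $A^1\wedge\dots\wedge A^m=\{a_1,\dots,a_{d'}\}$ with $a_i=\min_j a^j_i$, where $a^j_i=+\infty$ if $i>r_j$. For a PGS $\mathcal{G}=\{G^1,\dots,G^m\}$, $G^j=\{g^j_1<\dots<g^j_{r_j}\}$, put $G^j_{i_j}=\{1\}\cup[i_j+1,g^j_{i_j}]$ for $i_j\in[r_j]$, and let $\mathcal{H}(\mathcal{G})$ be the set of all $H\subseteq[n]$ with $H\le G^1_{i_1}\wedge\dots\wedge G^m_{i_m}$ for some $(i_1,\dots,i_m)\in[r_1]\times\dots\times[r_m]$. Generators: every MLCIF $\mathcal{A}\subseteq\binom{[n]}{k}$ can be written as $\mathcal{A}=\mathcal{F}(\mathcal{G})\cup\mathcal{F}(\mathcal{H}(\mathcal{G}))$ for a PGS $\mathcal{G}$; the generators of $\mathcal{A}$ are the members of $\mathcal{G}\cup\mathcal{H}(\mathcal{G})$. A generator $G$ is maximal if there is no generator $G'\ne G$ with $G\preceq G'$. The rank of $\mathcal{A}$ is the minimum size of a generator. *)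

theory Defs
  imports Main "HOL-Library.Ramsey"
begin

text \<open>The ground set $[n]$ is \<open>{1..n}\<close>, and $\binom{[n]}{k}$ is \<open>nsets {1..n} k\<close>.\<close>

text \<open>\<open>elt A i\<close> is the \<open>i\<close>-th smallest element $a_i$ of a finite set \<open>A\<close>, counted from 1;
  it is only meaningful for \<open>1 \<le> i \<le> card A\<close>.\<close>

definition elt :: "nat set \<Rightarrow> nat \<Rightarrow> nat" where
  "elt A i = sorted_list_of_set A ! (i - 1)"

definition set_le :: "nat set \<Rightarrow> nat set \<Rightarrow> bool" where
  "set_le A B \<longleftrightarrow> card A = card B \<and> (\<forall>i\<in>{1..card B}. elt A i \<le> elt B i)"

definition set_prec :: "nat set \<Rightarrow> nat set \<Rightarrow> bool" where
  "set_prec A B \<longleftrightarrow> card B \<le> card A \<and> (\<forall>i\<in>{1..card B}. elt A i \<le> elt B i)"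

definition hitting :: "nat set set \<Rightarrow> nat set \<Rightarrow> nat set set" where
  "hitting \<B> X = {B \<in> \<B>. B \<inter> X \<noteq> {}}"

definition star :: "nat \<Rightarrow> nat \<Rightarrow> nat set set" where
  "star n k = {A \<in> nsets {1..n} k. 1 \<in> A}"

definition gen_family :: "nat \<Rightarrow> nat \<Rightarrow> nat set set \<Rightarrow> nat set set" where
  "gen_family n k \<G> = {S \<in> nsets {1..n} k. \<exists>G\<in>\<G>. set_prec S G}"

definition intersecting :: "nat set set \<Rightarrow> bool" where
  "intersecting \<A> \<longleftrightarrow> (\<forall>S\<in>\<A>. \<forall>T\<in>\<A>. S \<inter> T \<noteq> {})"

definition left_compressed :: "nat \<Rightarrow> nat \<Rightarrow> nat set set \<Rightarrow> bool" where
  "left_compressed n k \<A> \<longleftrightarrow> (\<forall>A\<in>\<A>. \<forall>B\<in>nsets {1..n} k. set_le B A \<longrightarrow> B \<in> \<A>)"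

definition maximal_intersecting :: "nat \<Rightarrow> nat \<Rightarrow> nat set set \<Rightarrow> bool" where
  "maximal_intersecting n k \<A> \<longleftrightarrow>
     intersecting \<A> \<and> (\<forall>S\<in>nsets {1..n} k - \<A>. \<not> intersecting (insert S \<A>))"

definition MLCIF :: "nat \<Rightarrow> nat \<Rightarrow> nat set set \<Rightarrow> bool" where
  "MLCIF n k \<A> \<longleftrightarrow>
     \<A> \<subseteq> nsets {1..n} k \<and> left_compressed n k \<A> \<and> maximal_intersecting n k \<A>"

definition strongly_intersecting :: "nat \<Rightarrow> nat set \<Rightarrow> nat set \<Rightarrow> bool" where
  "strongly_intersecting n A B \<longleftrightarrow>
     (\<forall>A' B'. A' \<subseteq> {1..n} \<and> B' \<subseteq> {1..n} \<and> set_le A' A \<and> set_le B' B \<longrightarrow> A' \<inter> B' \<noteq> {})"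

definition pregenerators :: "nat \<Rightarrow> nat set set" where
  "pregenerators k =
     {G. G \<subseteq> {1..2*k-1} \<and> card G \<le> k \<and> card (G \<inter> {1..k + card G - 1}) = card G}"

definition PGS :: "nat \<Rightarrow> nat \<Rightarrow> nat set set \<Rightarrow> bool" where
  "PGS n k \<G> \<longleftrightarrow> \<G> \<subseteq> pregenerators k \<and> (\<forall>G\<in>\<G>. 1 \<notin> G) \<and>
     (\<forall>G\<in>\<G>. \<forall>G'\<in>\<G>. strongly_intersecting n G G')"

text \<open>The convention $a^j_i = +\infty$ for $i > r_j$ is rendered by leaving the sets with fewer
  than \<open>i\<close> elements out of the minimum. \<open>Inf\<close> and \<open>Sup\<close> are taken in \<^typ>\<open>nat\<close>; for a finite
  nonempty family they are the minimum and maximum. The meet of the empty family is empty.\<close>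

definition meet :: "nat set set \<Rightarrow> nat set" where
  "meet \<B> = (\<lambda>i. Inf {elt B i |B. B \<in> \<B> \<and> i \<le> card B}) ` {1..Sup (card ` \<B>)}"

definition sub_gen :: "nat set \<Rightarrow> nat \<Rightarrow> nat set" where
  "sub_gen G i = {1} \<union> {i + 1..elt G i}"

text \<open>The tuple $(i_1,\dots,i_m)$ is the function \<open>\<iota>\<close>, indexed by the members of \<open>\<G>\<close>.\<close>

definition derived_gens :: "nat \<Rightarrow> nat set set \<Rightarrow> nat set set" where
  "derived_gens n \<G> = {H. H \<subseteq> {1..n} \<and>
     (\<exists>\<iota>. (\<forall>G\<in>\<G>. \<iota> G \<in> {1..card G}) \<and> set_le H (meet ((\<lambda>G. sub_gen G (\<iota> G)) ` \<G>)))}"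

text \<open>A family may be generated by more than one PGS, so generators, maximal generators and rank
  are notions relative to a PGS \<open>\<G>\<close> that generates the family.\<close>

definition generated_by :: "nat \<Rightarrow> nat \<Rightarrow> nat set set \<Rightarrow> nat set set \<Rightarrow> bool" where
  "generated_by n k \<A> \<G> \<longleftrightarrow>
     PGS n k \<G> \<and> \<A> = gen_family n k \<G> \<union> gen_family n k (derived_gens n \<G>)"

definition generators :: "nat \<Rightarrow> nat set set \<Rightarrow> nat set set" where
  "generators n \<G> = \<G> \<union> derived_gens n \<G>"

definition maximal_generators :: "nat \<Rightarrow> nat set set \<Rightarrow> nat set set" where
  "maximal_generators n \<G> =
     {G \<in> generators n \<G>. \<not> (\<exists>G'\<in>generators n \<G>. G' \<noteq> G \<and> set_prec G G')}"

definition gen_rank :: "nat \<Rightarrow> nat set set \<Rightarrow> nat" where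
  "gen_rank n \<G> = Min (card ` generators n \<G>)"

end

theory Submission
  imports Complex_Main Defs
begin

text \<open>Unfolding the orders, a \<open>k\<close>-set belongs to \<open>\<A>\<close> iff it contains 1 and meets \<open>[2,b]\<close>, or
  omits 1 and contains \<open>[2,b]\<close>. The two formulas are then inclusion--exclusion. Comparing with the
  star, the sets of the first kind lose $\binom{n-b}{k-1} - \binom{n-|X\cup[b]|}{k-1}$ members and
  the sets of the second kind gain at most $\binom{n-b}{k+1-b}$; the inequalities then come down
  to the growth of $\binom{m}{q} - \binom{m}{p}$ in \<open>m\<close> for \<open>p \<le> q\<close>.\<close>

section \<open>Order statistics and the two orders, expressed by counting in initial
  segments\<close>

text \<open>In the sorted list the elements of \<open>S\<close> that are at most \<open>m\<close>
  form an initial segment, and the \<open>i\<close>-th entry lies in it iff its length is at least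
  \<open>i\<close>. Comparisons of \<open>elt\<close> thus become cardinality bounds.\<close>

lemma elt_le_iff:
  assumes "finite S" "1 \<le> i" "i \<le> card S"
  shows "elt S i \<le> m \<longleftrightarrow> i \<le> card (S \<inter> {..m})"
proof -
  let ?xs = "sorted_list_of_set S"
  have len: "length ?xs = card S" and set: "set ?xs = S" and dist: "distinct ?xs" and srt: "sorted ?xs"
    using assms(1) by simp_all
  have fin: "finite (S \<inter> {..m})" using assms(1) by simp
  show ?thesis
  proof
    assume le: "elt S i \<le> m"
    have "set (take i ?xs) \<subseteq> S \<inter> {..m}"
    proof
      fix x assume "x \<in> set (take i ?xs)"
      then obtain j where j: "j < i" "j < length ?xs" "x = ?xs ! j"
        by (auto simp: in_set_conv_nth)
      have "?xs ! j \<le> ?xs ! (i - 1)"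
        using srt j assms len by (intro sorted_nth_mono) auto
      with le j show "x \<in> S \<inter> {..m}"
        using set nth_mem[OF j(2)] by (auto simp: elt_def)
    qed
    from card_mono[OF fin this] show "i \<le> card (S \<inter> {..m})"
      using dist len assms(3) by (simp add: distinct_card)
  next
    assume le: "i \<le> card (S \<inter> {..m})"
    show "elt S i \<le> m"
    proof (rule ccontr)
      assume gt: "\<not> elt S i \<le> m"
      have "S \<inter> {..m} \<subseteq> set (take (i - 1) ?xs)"
      proof
        fix x assume x: "x \<in> S \<inter> {..m}"
        then have "x \<in> set ?xs" using set by simp
        then obtain j where j: "j < length ?xs" "x = ?xs ! j"
          by (auto simp: in_set_conv_nth)
        have "j < i - 1"
        proof (rule ccontr)
          assume "\<not> j < i - 1"
          then have "?xs ! (i - 1) \<le> ?xs ! j"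
            using srt j by (intro sorted_nth_mono) auto
          with gt x j show False by (auto simp: elt_def)
        qed
        with j show "x \<in> set (take (i - 1) ?xs)" by (auto simp: in_set_conv_nth)
      qed
      from card_mono[OF _ this] have "card (S \<inter> {..m}) \<le> i - 1"
        using card_length[of "take (i - 1) ?xs"] by simp
      with le assms(2) show False by simp
    qed
  qed
qed

lemma elt_atLeastAtMost:
  assumes "1 \<le> i" "i + a \<le> b + 1"
  shows "elt {a..b} i = a + i - 1"
proof -
  \<comment> \<open>The value is pinned down by its upper bounds: two naturals with the same upper
    bounds are equal.\<close>
  have "elt {a..b} i \<le> m \<longleftrightarrow> a + i - 1 \<le> m" for m
  proof -
    have "{a..b} \<inter> {..m} = {a..min b m}" by auto
    then show ?thesis using elt_le_iff[of "{a..b}" i m] assms by auto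
  qed
  then show ?thesis by (meson order.antisym order.refl)
qed

text \<open>The condition at index \<open>i\<close> asks for \<open>i\<close> elements of
  \<open>S\<close> in \<open>{..i + 1}\<close>. The last one, at \<open>i = b - 1\<close>, implies
  all others, because going down from \<open>b\<close> to \<open>i + 1\<close> loses at most
  \<open>b - 1 - i\<close> elements.\<close>

lemma set_prec_interval_iff:
  assumes "finite S" "b \<le> card S + 1"
  shows "set_prec S {2..b} \<longleftrightarrow> b - 1 \<le> card (S \<inter> {..b})"
proof (cases "b \<le> 1")
  case True
  then show ?thesis by (simp add: set_prec_def)
next
  case False
  have "set_prec S {2..b} \<longleftrightarrow> (\<forall>i\<in>{1..b - 1}. i \<le> card (S \<inter> {..i + 1}))"
  proof -
    have "elt S i \<le> elt {2..b} i \<longleftrightarrow> i \<le> card (S \<inter> {..i + 1})" if "i \<in> {1..b - 1}" for i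
      using elt_le_iff[of S i "i + 1"] elt_atLeastAtMost[of i 2 b] that assms by auto
    moreover have "b - 1 \<le> card S" using assms(2) by simp
    ultimately show ?thesis by (simp add: set_prec_def)
  qed
  also have "\<dots> \<longleftrightarrow> b - 1 \<le> card (S \<inter> {..b})"
  proof
    assume "\<forall>i\<in>{1..b - 1}. i \<le> card (S \<inter> {..i + 1})"
    from this[rule_format, of "b - 1"] False show "b - 1 \<le> card (S \<inter> {..b})" by simp
  next
    assume le: "b - 1 \<le> card (S \<inter> {..b})"
    show "\<forall>i\<in>{1..b - 1}. i \<le> card (S \<inter> {..i + 1})"
    proof
      fix i assume i: "i \<in> {1..b - 1}"
      have "S \<inter> {..b} \<subseteq> (S \<inter> {..i + 1}) \<union> {i + 2..b}" by auto
      then have "card (S \<inter> {..b}) \<le> card ((S \<inter> {..i + 1}) \<union> {i + 2..b})"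
        by (intro card_mono) auto
      also have "\<dots> \<le> card (S \<inter> {..i + 1}) + card {i + 2..b}" by (rule card_Un_le)
      finally show "i \<le> card (S \<inter> {..i + 1})" using le i by auto
    qed
  qed
  finally show ?thesis .
qed

text \<open>The two index conditions ask for one element up to 1 and two elements up to
  \<open>b\<close>. As 0 is not in \<open>S\<close>, the first means that 1 is in \<open>S\<close>,
  and then the second asks for a further element in \<open>{2..b}\<close>.\<close>

lemma set_prec_pair_iff:
  assumes "S \<subseteq> {1..}" "finite S" "2 \<le> card S" "2 \<le> b"
  shows "set_prec S {1, b} \<longleftrightarrow> 1 \<in> S \<and> S \<inter> {2..b} \<noteq> {}"
proof -
  have elts: "elt {1, b} 1 = 1" "elt {1, b} 2 = b" "card {1, b} = 2"
    using assms(4) by (simp_all add: elt_def)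
  have "{1..2::nat} = {1, 2}" by auto
  then have "set_prec S {1, b} \<longleftrightarrow> 1 \<le> card (S \<inter> {..1}) \<and> 2 \<le> card (S \<inter> {..b})"
    using assms by (simp add: set_prec_def elts elt_le_iff del: One_nat_def)
  also have "1 \<le> card (S \<inter> {..1}) \<longleftrightarrow> 1 \<in> S"
  proof -
    have "S \<inter> {..1} = S \<inter> {1}" using assms(1) by (auto simp: subset_iff order_antisym)
    then show ?thesis by (cases "1 \<in> S") auto
  qed
  also have "1 \<in> S \<and> 2 \<le> card (S \<inter> {..b}) \<longleftrightarrow> 1 \<in> S \<and> S \<inter> {2..b} \<noteq> {}"
  proof (rule conj_cong[OF refl])
    assume "1 \<in> S"
    then have "S \<inter> {..b} = insert 1 (S \<inter> {2..b})"
      using assms(1,4) by force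
    then have "card (S \<inter> {..b}) = Suc (card (S \<inter> {2..b}))"
      using assms(2) by simp
    then show "2 \<le> card (S \<inter> {..b}) \<longleftrightarrow> S \<inter> {2..b} \<noteq> {}"
      using assms(2) by (auto simp: numeral_2_eq_2 Suc_le_eq card_gt_0_iff)
  qed
  finally show ?thesis .
qed

text \<open>A set containing 1 that precedes \<open>{2..b}\<close> has at least
  \<open>b - 2 > 0\<close> elements in \<open>{2..b}\<close>, so it already precedes
  \<open>{1, b}\<close>. What \<open>{2..b}\<close> adds are the sets without 1, which need all
  \<open>b - 1\<close> elements of the interval.\<close>

lemma two_generator_family_eq:
  assumes "4 \<le> b" "b \<le> k + 1"
  shows "gen_family n k {{2..b}} \<union> gen_family n k {{1, b}} =
    {S \<in> nsets {1..n} k. 1 \<in> S \<and> S \<inter> {2..b} \<noteq> {}} \<union>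
    {S \<in> nsets {1..n} k. 1 \<notin> S \<and> {2..b} \<subseteq> S}"
proof -
  have "set_prec S {2..b} \<or> set_prec S {1, b} \<longleftrightarrow>
      1 \<in> S \<and> S \<inter> {2..b} \<noteq> {} \<or> 1 \<notin> S \<and> {2..b} \<subseteq> S"
    if S: "S \<in> nsets {1..n} k" for S
  proof -
    have fin: "finite S" and card: "card S = k" and sub: "S \<subseteq> {1..n}"
      using S by (auto simp: nsets_def)
    have split: "S \<inter> {..b} = (S \<inter> {1}) \<union> (S \<inter> {2..b})"
      using sub assms(1) by force
    have card_split: "card (S \<inter> {..b}) = card (S \<inter> {1}) + card (S \<inter> {2..b})"
      unfolding split using fin by (intro card_Un_disjoint) auto
    have "card {2..b} \<le> card (S \<inter> {2..b}) \<Longrightarrow> S \<inter> {2..b} = {2..b}"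
      by (intro card_seteq) auto
    then have full: "b - 1 \<le> card (S \<inter> {2..b}) \<longleftrightarrow> {2..b} \<subseteq> S"
      by (auto simp: Int_absorb1)
    have hit: "0 < card (S \<inter> {2..b}) \<longleftrightarrow> S \<inter> {2..b} \<noteq> {}"
      using fin by (auto simp: card_gt_0_iff)
    have "set_prec S {2..b} \<longleftrightarrow> b - 1 \<le> card (S \<inter> {1}) + card (S \<inter> {2..b})"
      using set_prec_interval_iff[OF fin, of b] card assms(2) card_split by simp
    moreover have "set_prec S {1, b} \<longleftrightarrow> 1 \<in> S \<and> S \<inter> {2..b} \<noteq> {}"
      using sub fin card assms by (intro set_prec_pair_iff) auto
    ultimately show ?thesis
      using full hit assms(1) by (cases "1 \<in> S") auto
  qed
  then show ?thesis by (auto simp: gen_family_def)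
qed

section \<open>Counting by prescribed and forbidden elements\<close>

text \<open>Deleting \<open>P\<close> is a bijection onto the \<open>(k - card P)\<close>-subsets of
  \<open>U - P - Q\<close>. The bound \<open>card P \<le> k\<close> keeps the truncated lower index
  from becoming 0 when no such \<open>S\<close> exists.\<close>

lemma card_nsets_containing_avoiding:
  assumes "finite U" "P \<subseteq> U" "Q \<subseteq> U" "P \<inter> Q = {}" "card P \<le> k"
  shows "card {S \<in> nsets U k. P \<subseteq> S \<and> S \<inter> Q = {}} =
    (card U - card P - card Q) choose (k - card P)"
proof -
  have finP: "finite P" and finQ: "finite Q" using assms finite_subset by blast+
  have "bij_betw (\<lambda>T. T \<union> P) (nsets (U - P - Q) (k - card P))
      {S \<in> nsets U k. P \<subseteq> S \<and> S \<inter> Q = {}}"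
  proof (rule bij_betw_byWitness[where f' = "\<lambda>S. S - P"])
    show "(\<lambda>T. T \<union> P) ` nsets (U - P - Q) (k - card P)
        \<subseteq> {S \<in> nsets U k. P \<subseteq> S \<and> S \<inter> Q = {}}"
    proof
      fix S assume "S \<in> (\<lambda>T. T \<union> P) ` nsets (U - P - Q) (k - card P)"
      then obtain T where T: "T \<subseteq> U - P - Q" "finite T" "card T = k - card P" "S = T \<union> P"
        by (auto simp: nsets_def)
      then have "T \<inter> P = {}" by auto
      with T finP have "card S = card T + card P" by (simp add: card_Un_disjoint)
      with T finP assms show "S \<in> {S \<in> nsets U k. P \<subseteq> S \<and> S \<inter> Q = {}}"
        by (auto simp: nsets_def)
    qed
  qed (use finP in \<open>auto simp: nsets_def card_Diff_subset\<close>)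
  then have "card {S \<in> nsets U k. P \<subseteq> S \<and> S \<inter> Q = {}} = card (nsets (U - P - Q) (k - card P))"
    by (rule bij_betw_same_card[symmetric])
  also have "\<dots> = card (U - P - Q) choose (k - card P)"
    by (rule card_nsets)
  also have "card (U - P - Q) = card U - card P - card Q"
    using assms finP finQ by (subst card_Diff_subset) (auto simp: card_Diff_subset)
  finally show ?thesis .
qed

text \<open>Inclusion-exclusion on the complement. Working in \<open>int\<close> from here on avoids
  truncated subtraction between counts.\<close>

lemma card_hitting_two:
  fixes \<F> :: "'a set set"
  assumes "finite \<F>"
  shows "int (card {S \<in> \<F>. S \<inter> Y \<noteq> {} \<and> S \<inter> X \<noteq> {}}) =
    int (card \<F>) - int (card {S \<in> \<F>. S \<inter> Y = {}}) - int (card {S \<in> \<F>. S \<inter> X = {}})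
    + int (card {S \<in> \<F>. S \<inter> (X \<union> Y) = {}})"
proof -
  let ?Y = "{S \<in> \<F>. S \<inter> Y = {}}" and ?X = "{S \<in> \<F>. S \<inter> X = {}}"
  have "{S \<in> \<F>. S \<inter> Y \<noteq> {} \<and> S \<inter> X \<noteq> {}} = \<F> - (?Y \<union> ?X)" by auto
  moreover have "card (\<F> - (?Y \<union> ?X)) = card \<F> - card (?Y \<union> ?X)"
    using assms by (intro card_Diff_subset) auto
  moreover have "card (?Y \<union> ?X) \<le> card \<F>" using assms by (intro card_mono) auto
  moreover have "card ?Y + card ?X = card (?Y \<union> ?X) + card (?Y \<inter> ?X)"
    using assms by (intro card_Un_Int) auto
  moreover have "?Y \<inter> ?X = {S \<in> \<F>. S \<inter> (X \<union> Y) = {}}" by auto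
  ultimately show ?thesis by simp
qed

lemma card_hitting_one:
  assumes "finite \<F>"
  shows "int (card {S \<in> \<F>. S \<inter> X \<noteq> {}}) = int (card \<F>) - int (card {S \<in> \<F>. S \<inter> X = {}})"
proof -
  have "{S \<in> \<F>. S \<inter> X \<noteq> {}} = \<F> - {S \<in> \<F>. S \<inter> X = {}}" by auto
  then show ?thesis using assms by (simp add: card_Diff_subset card_mono of_nat_diff)
qed

lemma card_hitting_star:
  assumes "1 \<le> k" "1 \<le> n" "X \<subseteq> {2..n}"
  shows "int (card (hitting (star n k) X)) =
    int ((n - 1) choose (k - 1)) - int ((n - card X - 1) choose (k - 1))"
proof -
  have fin: "finite (star n k)" by (simp add: star_def finite_imp_finite_nsets)
  have "star n k = {S \<in> nsets {1..n} k. {1} \<subseteq> S \<and> S \<inter> {} = {}}" by (auto simp: star_def)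
  then have "card (star n k) = (n - 1) choose (k - 1)"
    using card_nsets_containing_avoiding[of "{1..n}" "{1}" "{}" k] assms by simp
  moreover have "{S \<in> star n k. S \<inter> X = {}} = {S \<in> nsets {1..n} k. {1} \<subseteq> S \<and> S \<inter> X = {}}"
    by (auto simp: star_def)
  then have "card {S \<in> star n k. S \<inter> X = {}} = (n - 1 - card X) choose (k - 1)"
    using card_nsets_containing_avoiding[of "{1..n}" "{1}" X k] assms by force
  ultimately show ?thesis
    using card_hitting_one[OF fin, of X] by (simp add: hitting_def diff_right_commute)
qed

lemma card_star_hitting_interval_and:
  assumes "1 \<le> k" "1 \<le> b" "b \<le> n" "X \<subseteq> {2..n}"
  shows "int (card {S \<in> nsets {1..n} k. 1 \<in> S \<and> S \<inter> {2..b} \<noteq> {} \<and> S \<inter> X \<noteq> {}}) =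
    int ((n - 1) choose (k - 1)) - int ((n - b) choose (k - 1))
    - int ((n - card X - 1) choose (k - 1))
    + int ((n + card (X \<inter> {1..b}) - card X - b) choose (k - 1))"
proof -
  have fin: "finite (star n k)" by (simp add: star_def finite_imp_finite_nsets)
  have cnt: "card {S \<in> star n k. S \<inter> Q = {}} = (n - 1 - card Q) choose (k - 1)"
    if "Q \<subseteq> {2..n}" for Q
  proof -
    have "{S \<in> star n k. S \<inter> Q = {}} = {S \<in> nsets {1..n} k. {1} \<subseteq> S \<and> S \<inter> Q = {}}"
      by (auto simp: star_def)
    then show ?thesis
      using card_nsets_containing_avoiding[of "{1..n}" "{1}" Q k] assms that by force
  qed
  have finX: "finite X" using assms(4) finite_subset by blast
  have "X \<inter> {1..b} = X \<inter> {2..b}" using assms(4) by auto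
  moreover have "card X + card {2..b} = card (X \<union> {2..b}) + card (X \<inter> {2..b})"
    using finX by (intro card_Un_Int) auto
  moreover have "card (X \<union> {2..b}) \<le> card {2..n}"
    using assms by (intro card_mono) auto
  \<comment> \<open>Adding the size of the intersection before subtracting keeps the natural
    subtraction exact, since the union fits into \<open>{2..n}\<close>.\<close>
  ultimately have un: "n - 1 - card (X \<union> {2..b}) = n + card (X \<inter> {1..b}) - card X - b"
    using assms by simp
  have eq: "{S \<in> nsets {1..n} k. 1 \<in> S \<and> S \<inter> {2..b} \<noteq> {} \<and> S \<inter> X \<noteq> {}} =
      {S \<in> star n k. S \<inter> {2..b} \<noteq> {} \<and> S \<inter> X \<noteq> {}}" by (auto simp: star_def)
  show ?thesis unfolding eq card_hitting_two[OF fin]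
    using cnt[of "{2..b}"] cnt[of X] cnt[of "X \<union> {2..b}"] cnt[of "{}"] assms un
    by (simp add: diff_right_commute)
qed

text \<open>Both formulas at once: the sets with 1 are counted by the previous lemma, and from the
  sets without 1 those missing \<open>X\<close> are removed. None of the latter exist when
  \<open>X\<close> meets \<open>{2..b}\<close>, which accounts for the conditional term.\<close>

lemma card_hitting_two_generator_family:
  assumes "4 \<le> b" "b \<le> k + 1" "b \<le> n" "X \<subseteq> {2..n}"
  shows "int (card (hitting (gen_family n k {{2..b}} \<union> gen_family n k {{1, b}}) X)) =
    int ((n - 1) choose (k - 1)) - int ((n - b) choose (k - 1))
    + int ((n - b) choose (k + 1 - b)) - int ((n - card X - 1) choose (k - 1))
    + int ((n + card (X \<inter> {1..b}) - card X - b) choose (k - 1))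
    - (if X \<inter> {2..b} = {} then int ((n - card X - b) choose (k + 1 - b)) else 0)"
proof -
  let ?A = "{S \<in> nsets {1..n} k. 1 \<in> S \<and> S \<inter> {2..b} \<noteq> {} \<and> S \<inter> X \<noteq> {}}"
  let ?C = "{S \<in> nsets {1..n} k. 1 \<notin> S \<and> {2..b} \<subseteq> S}"
  let ?B = "{S \<in> ?C. S \<inter> X \<noteq> {}}"
  have fin: "finite ?A" "finite ?C" by (simp_all add: finite_imp_finite_nsets)
  have "hitting (gen_family n k {{2..b}} \<union> gen_family n k {{1, b}}) X = ?A \<union> ?B"
    unfolding two_generator_family_eq[OF assms(1,2)] by (auto simp: hitting_def)
  moreover have "card (?A \<union> ?B) = card ?A + card ?B"
    using fin(1) finite_subset[OF _ fin(2), of ?B] by (intro card_Un_disjoint) auto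
  ultimately have card: "card (hitting (gen_family n k {{2..b}} \<union> gen_family n k {{1, b}}) X) =
      card ?A + card ?B" by simp
  \<comment> \<open>The lower index is written \<open>k + 1 - b\<close> because
    \<open>k - b + 1\<close> would evaluate to 1 instead of 0 on naturals at
    \<open>b = k + 1\<close>.\<close>
  have kb: "k - (b - 1) = k + 1 - b" using assms by simp
  have "?C = {S \<in> nsets {1..n} k. {2..b} \<subseteq> S \<and> S \<inter> {1} = {}}" by auto
  then have C: "card ?C = (n - b) choose (k + 1 - b)"
    using card_nsets_containing_avoiding[of "{1..n}" "{2..b}" "{1}" k] assms kb by force
  have B: "int (card ?B) = int (card ?C) - int (card {S \<in> ?C. S \<inter> X = {}})"
    by (rule card_hitting_one[OF fin(2)])
  have "card {S \<in> ?C. S \<inter> X = {}} =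
      (if X \<inter> {2..b} = {} then (n - card X - b) choose (k + 1 - b) else 0)"
  proof (cases "X \<inter> {2..b} = {}")
    case True
    \<comment> \<open>Omitting 1 is treated as one more forbidden element, so the forbidden set has
      \<open>card X + 1\<close> elements.\<close>
    have eq: "{S \<in> ?C. S \<inter> X = {}} = {S \<in> nsets {1..n} k. {2..b} \<subseteq> S \<and> S \<inter> insert 1 X = {}}"
      by auto
    have "1 \<notin> X" "finite X" using assms(4) finite_subset by auto
    then have "card (insert 1 X) = Suc (card X)" by simp
    moreover have "card {S \<in> nsets {1..n} k. {2..b} \<subseteq> S \<and> S \<inter> insert 1 X = {}} =
        (card {1..n} - card {2..b} - card (insert 1 X)) choose (k - card {2..b})"
      using assms True by (intro card_nsets_containing_avoiding) auto
    moreover have "n - (b - 1) - Suc (card X) = n - card X - b" using assms(1) by simp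
    ultimately show ?thesis using True kb eq by simp
  next
    case False
    then have empty: "{S \<in> ?C. S \<inter> X = {}} = {}" by auto
    show ?thesis unfolding empty using False by simp
  qed
  with card B C card_star_hitting_interval_and[of k b n X] assms show ?thesis by auto
qed

section \<open>Inequalities between binomial coefficients\<close>

text \<open>The hypotheses say that \<open>p\<close> is at most both \<open>q\<close> and
  \<open>N - q\<close>; one of these lies in the lower half of the row, where the coefficients
  increase.\<close>

lemma binomial_le_of_add_le:
  fixes p q N :: nat
  assumes "p \<le> q" "p + q \<le> N"
  shows "N choose p \<le> N choose q"
proof (cases "2 * q \<le> N")
  case True
  with assms show ?thesis by (intro binomial_mono) auto
next
  case False
  have "N choose p \<le> N choose (N - q)"
    using assms False by (intro binomial_mono) auto
  with assms show ?thesis by (simp flip: binomial_symmetric)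
qed

text \<open>Reflecting \<open>q\<close> to \<open>N - q\<close>, which is at most \<open>p\<close>,
  reduces this to the previous lemma; for \<open>q > N\<close> the left side is 0.\<close>

lemma binomial_ge_of_le_add:
  fixes p q N :: nat
  assumes "p \<le> q" "N \<le> p + q"
  shows "N choose q \<le> N choose p"
proof (cases "q \<le> N")
  case True
  then have "N choose q = N choose (N - q)" by (rule binomial_symmetric)
  also have "\<dots> \<le> N choose p" using assms True by (intro binomial_le_of_add_le) auto
  finally show ?thesis .
qed (simp add: binomial_eq_0)

text \<open>The difference \<open>(m choose q) - (m choose p)\<close> is nonpositive up to \<open>m = p + q\<close> and
  nondecreasing and nonnegative from there on.\<close>

lemma binomial_gap_mono:
  fixes p q M N :: nat
  assumes "p \<le> q" "p + q \<le> N" "M \<le> N"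
  shows "(N choose p) + (M choose q) \<le> (N choose q) + (M choose p)"
proof (cases "M \<le> p + q")
  case True
  then show ?thesis
    using binomial_le_of_add_le[OF assms(1,2)] binomial_ge_of_le_add[OF assms(1)] by (simp add: add_mono)
next
  case False
  show ?thesis using assms(3)
  proof (induction N rule: dec_induct)
    case base
    show ?case by simp
  next
    case (step m)
    \<comment> \<open>By Pascal's rule the gap grows by
      \<open>(m choose (q - 1)) - (m choose (p - 1))\<close> for positive \<open>p\<close>, which is
      nonnegative as \<open>p + q < m\<close> here.\<close>
    have "(Suc m choose p) + (m choose q) \<le> (Suc m choose q) + (m choose p)"
    proof (cases p)
      case 0
      then show ?thesis by (cases q) auto
    next
      case (Suc p')
      then obtain q' where "q = Suc q'" using assms(1) by (cases q) auto
      moreover have "m choose p' \<le> m choose q'"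
        using Suc \<open>q = Suc q'\<close> assms(1) False step.hyps by (intro binomial_le_of_add_le) auto
      ultimately show ?thesis using Suc by simp
    qed
    with step.IH show ?case by simp
  qed
qed

text \<open>With \<open>M = N - 1\<close>, Pascal's rule gives
  \<open>N choose r \<le> 2 * (M choose r)\<close>, while the ratio of
  \<open>M choose (r + 1)\<close> to \<open>M choose r\<close> is \<open>(M - r) / (r + 1)\<close>.
  This exceeds 2 exactly when \<open>3 * r + 4 \<le> N\<close>.\<close>

lemma binomial_less_pred_Suc:
  fixes j r N :: nat
  assumes "j \<le> r" "3 * r + 4 \<le> N"
  shows "N choose j < (N - 1) choose (r + 1)"
proof -
  obtain M where M: "N = Suc M" using assms by (cases N) auto
  have pos: "0 < M choose r" using assms M by simp
  have "N choose j \<le> N choose r" using assms by (intro binomial_mono) auto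
  also have "\<dots> \<le> 2 * (M choose r)"
  proof (cases r)
    case (Suc r')
    have "M choose r' \<le> M choose r" using assms M Suc by (intro binomial_mono) auto
    with Suc M show ?thesis by simp
  qed simp
  finally have "(r + 1) * (N choose j) \<le> (r + 1) * (2 * (M choose r))" by (rule mult_left_mono) simp
  also have "\<dots> = (2 * r + 2) * (M choose r)" by (simp add: algebra_simps)
  also have "\<dots> < (M - r) * (M choose r)"
    using pos assms M by (intro mult_strict_right_mono) auto
  also have "\<dots> = (r + 1) * (M choose (r + 1))"
  proof -
    have "r + (M - Suc r) + 1 = M" and "M - r = Suc (M - Suc r)" using assms M by auto
    then show ?thesis using Suc_times_binomial_add[of r "M - Suc r"] by simp
  qed
  finally have "N choose j < M choose (r + 1)" by (simp only: mult_less_cancel1)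
  then show ?thesis using M by simp
qed

section \<open>Comparison of the family with the star\<close>

theorem theorem1p6:
  fixes k :: nat
  assumes "4 \<le> 2 * k"
  shows "\<exists>n\<^sub>0. \<forall>(n::nat) (b::nat) (d::nat) (X::nat set) (\<A>::nat set set) (\<G>::nat set set).
    2 * k \<le> n \<and> 4 \<le> b \<and> b \<le> k + 1 \<and>
    \<A> = gen_family n k {{2..b}} \<union> gen_family n k {{1, b}} \<and>
    MLCIF n k \<A> \<and>
    generated_by n k \<A> \<G> \<and> gen_rank n \<G> = 2 \<and> card (maximal_generators n \<G>) = 2 \<and>
    X \<subseteq> {2..n} \<and> card X = d \<longrightarrow>
    (X \<inter> {2..b} \<noteq> {} \<longrightarrow>
      int (card (hitting \<A> X)) =
        int ((n - 1) choose (k - 1)) - int ((n - b) choose (k - 1))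
        + int ((n - b) choose (k + 1 - b)) - int ((n - d - 1) choose (k - 1))
        + int ((n + card (X \<inter> {1..b}) - d - b) choose (k - 1)) \<and>
      (X \<subseteq> {2..b} \<longrightarrow>
        card (hitting \<A> X) = card (hitting (star n k) X) + ((n - b) choose (k + 1 - b))) \<and>
      (X \<inter> {2..b} \<subset> X \<and> n\<^sub>0 \<le> n \<longrightarrow>
        card (hitting \<A> X) < card (hitting (star n k) X))) \<and>
    (X \<inter> {2..b} = {} \<longrightarrow>
      int (card (hitting \<A> X)) =
        int ((n - 1) choose (k - 1)) - int ((n - b) choose (k - 1))
        + int ((n - b) choose (k + 1 - b)) - int ((n - d - 1) choose (k - 1))
        + int ((n - d - b) choose (k - 1)) - int ((n - d - b) choose (k + 1 - b)) \<and>
      card (hitting \<A> X) \<le> card (hitting (star n k) X))"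
\<comment> \<open>The threshold depends on \<open>k\<close> alone: with \<open>b \<le> k + 1\<close>
  it yields \<open>n - b \<ge> 3 * k\<close>, enough for \<open>binomial_less_pred_Suc\<close> at
  \<open>r = k - 3\<close>.\<close>
proof (intro exI[of _ "4 * k + 1"] allI impI, elim conjE, intro conjI impI)
  fix n b d :: nat and X :: "nat set" and \<A> \<G> :: "nat set set"
  assume nk: "2 * k \<le> n" and b: "4 \<le> b" "b \<le> k + 1"
    and \<A>: "\<A> = gen_family n k {{2..b}} \<union> gen_family n k {{1, b}}"
    and X: "X \<subseteq> {2..n}" and d: "card X = d"
  have bn: "b \<le> n" using nk b by simp
  have kn: "1 \<le> k" "1 \<le> n" using nk b by simp_all
  note hitA = card_hitting_two_generator_family[OF b bn X, folded \<A>, unfolded d]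
  note hitS = card_hitting_star[OF kn X, unfolded d]
  have finX: "finite X" using X finite_subset by blast
  have X1: "X \<inter> {1..b} = X \<inter> {2..b}" using X by auto
  {
    assume "X \<inter> {2..b} \<noteq> {}"
    then show formula: "int (card (hitting \<A> X)) =
        int ((n - 1) choose (k - 1)) - int ((n - b) choose (k - 1))
        + int ((n - b) choose (k + 1 - b)) - int ((n - d - 1) choose (k - 1))
        + int ((n + card (X \<inter> {1..b}) - d - b) choose (k - 1))"
      using hitA by simp
    {
      assume "X \<subseteq> {2..b}"
      \<comment> \<open>The last binomial then becomes \<open>(n - b) choose (k - 1)\<close> and
        cancels the second one.\<close>
      then have "card (X \<inter> {1..b}) = d" using X1 d by (simp add: Int_absorb2)
      then show "card (hitting \<A> X) = card (hitting (star n k) X) + ((n - b) choose (k + 1 - b))"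
        using formula hitS by simp
    }
    {
      assume "X \<inter> {2..b} \<subset> X \<and> 4 * k + 1 \<le> n"
      then have ps: "X \<inter> {2..b} \<subset> X" and large: "4 * k + 1 \<le> n" by auto
      \<comment> \<open>An element of \<open>X\<close> beyond \<open>b\<close> leaves a loss of at
        least \<open>(n - b - 1) choose (k - 2)\<close> among the sets with 1, by Pascal's
        rule.\<close>
      have "card (X \<inter> {1..b}) < d" using psubset_card_mono[OF finX ps] d X1 by simp
      then have "(n + card (X \<inter> {1..b}) - d - b) choose (k - 1) \<le> (n - b - 1) choose (k - 1)"
        by (intro binomial_right_mono) simp
      \<comment> \<open>The gain from the sets without 1 is smaller than this loss:
        \<open>b \<ge> 4\<close> gives \<open>k + 1 - b \<le> k - 3\<close>, and
        \<open>k - 3 + 1\<close> is \<open>k - 2\<close>.\<close>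
      moreover have "(n - b) choose (k + 1 - b) < (n - b - 1) choose (k - 3 + 1)"
        using b large by (intro binomial_less_pred_Suc) auto
      moreover have "(n - b) choose (k - 1) =
          ((n - b - 1) choose (k - 3 + 1)) + ((n - b - 1) choose (k - 1))"
        using b large binomial_Suc_Suc[of "n - b - 1" "k - 2"]
        by (simp add: Suc_diff_Suc numeral_2_eq_2 numeral_3_eq_3)
      ultimately show "card (hitting \<A> X) < card (hitting (star n k) X)"
        using formula hitS by simp
    }
  }
  {
    assume disj: "X \<inter> {2..b} = {}"
    then show formula: "int (card (hitting \<A> X)) =
        int ((n - 1) choose (k - 1)) - int ((n - b) choose (k - 1))
        + int ((n - b) choose (k + 1 - b)) - int ((n - d - 1) choose (k - 1))
        + int ((n - d - b) choose (k - 1)) - int ((n - d - b) choose (k + 1 - b))"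
      using hitA X1 by simp
    \<comment> \<open>Here \<open>p = k + 1 - b\<close> and \<open>q = k - 1\<close>, so
      \<open>p + q = 2 * k - b\<close> is at most \<open>n - b\<close> precisely because
      \<open>2 * k \<le> n\<close>.\<close>
    have "((n - b) choose (k + 1 - b)) + ((n - d - b) choose (k - 1)) \<le>
        ((n - b) choose (k - 1)) + ((n - d - b) choose (k + 1 - b))"
      using b nk by (intro binomial_gap_mono) auto
    then show "card (hitting \<A> X) \<le> card (hitting (star n k) X)"
      using formula hitS by simp
  }
qed

end
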